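(* Let $\beta\in[0,1]$. If $f\in\mathcal{A}_\beta$ has the form $f(z)=z+\sum_{n=2}^\infty a_n z^n$, then for every integer $n\ge 2$ $$|a_n|\le \frac{2}{n-\beta(n-1)}.$$ Further, this inequality is sharp for each $n$.
   Context: $\mathbb{D}=\{z\in\mathbb{C}:|z|<1\}$. $\mathcal{A}$ is the class of holomorphic functions $f$ on $\mathbb{D}$ of the form $f(z)=z+\sum_{n=2}^\infty a_n z^n$. For $\beta\in[0,1]$, $\mathcal{A}_\beta=\{f\in\mathcal{A}:\operatorname{Re}(\beta \frac{f(z)}{z}+(1-\beta)f'(z))>0 \text{ for all } z\in\mathbb{D}\}$, where $f(z)/z$ takes the value $1$ at $z=0$. A bound being sharp means that equality is attained for some $f\in\mathcal{A}_\beta$. *)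

theory Defs
  imports "HOL-Complex_Analysis.Complex_Analysis"
begin

abbreviation unit_disc :: "complex set" where
  "unit_disc \<equiv> ball 0 1"

(* f(z) = z + a_2 z^2 + a_3 z^3 + ... on the unit disc; only the a n with n >= 2 occur,
   the values a 0 and a 1 are irrelevant. *)
definition normalized_expansion :: "(complex \<Rightarrow> complex) \<Rightarrow> (nat \<Rightarrow> complex) \<Rightarrow> bool" where
  "normalized_expansion f a \<longleftrightarrow>
     (\<forall>z\<in>unit_disc. summable (\<lambda>n. a (n + 2) * z ^ (n + 2)) \<and>
                    f z = z + (\<Sum>n. a (n + 2) * z ^ (n + 2)))"

(* Functions on the disc are represented by total functions whose values off the disc are
   unconstrained. *)
definition class_A :: "(complex \<Rightarrow> complex) set" where
  "class_A = {f. f holomorphic_on unit_disc \<and> (\<exists>a. normalized_expansion f a)}"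

definition quot_id :: "(complex \<Rightarrow> complex) \<Rightarrow> complex \<Rightarrow> complex" where
  "quot_id f z = (if z = 0 then 1 else f z / z)"

definition class_A_beta :: "real \<Rightarrow> (complex \<Rightarrow> complex) set" where
  "class_A_beta \<beta> =
     {f \<in> class_A. \<forall>z\<in>unit_disc.
        Re (of_real \<beta> * quot_id f z + (1 - of_real \<beta>) * deriv f z) > 0}"

end

theory Submission
  imports Defs
begin

text \<open>
  Write \<open>\<gamma>\<^sub>n = n - \<beta> (n - 1)\<close>, that is \<open>\<beta> + (1 - \<beta>) n\<close>. On Taylor coefficients the operator
  \<open>f \<mapsto> p = \<beta> f(z)/z + (1 - \<beta>) f'(z)\<close> is diagonal: the coefficient \<open>a\<^sub>n\<close> of \<open>f\<close> becomes the
  coefficient \<open>\<gamma>\<^sub>n a\<^sub>n\<close> of \<open>p\<close>, moved down by one degree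
  (\<open>class_A_beta_expression_sums\<close>). The defining condition says that \<open>p = 1 + \<dots>\<close> has positive
  real part, so the bound is Caratheodory's inequality \<open>|p\<^sub>k| \<le> 2\<close>
  (\<open>caratheodory_coefficient_bound\<close>) divided by \<open>\<gamma>\<^sub>n\<close>. For sharpness one solves for the \<open>f\<close> whose
  \<open>p\<close> is \<open>(1 + z)/(1 - z)\<close>; all coefficients of that \<open>p\<close> past the constant term equal \<open>2\<close>, so one
  function is extremal for all \<open>n\<close> at once.

  Caratheodory's bound for the first coefficient is Schwarz's lemma applied to the Cayley
  transform \<open>(p - 1)/(p + 1)\<close>. For the \<open>k\<close>-th coefficient, averaging \<open>p\<close> over the rotations by
  \<open>k\<close>-th roots of unity leaves only the powers of \<open>z\<^sup>k\<close>. The average is again of positive real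
  part, and as a function of \<open>w = z\<^sup>k\<close> its first coefficient is \<open>p\<^sub>k\<close>.
\<close>

section \<open>Coefficients of functions with positive real part\<close>

lemma unit_disc_power_series_holomorphic:
  assumes "\<And>z. z \<in> unit_disc \<Longrightarrow> (\<lambda>n. c n * z ^ n) sums g z"
  shows "g holomorphic_on unit_disc"
  by (rule power_series_holomorphic[of 0 1 c]) (use assms in simp)

lemma unit_disc_power_series_deriv_sums:
  assumes sums: "\<And>z. z \<in> unit_disc \<Longrightarrow> (\<lambda>n. c n * z ^ n) sums g z" and z: "z \<in> unit_disc"
  shows "(\<lambda>n. diffs c n * z ^ n) sums deriv g z"
proof (rule termdiffs_sums_strong)
  show "(g has_field_derivative deriv g z) (at z)"
    using unit_disc_power_series_holomorphic[OF sums] z by (auto intro: holomorphic_derivI)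
qed (use assms in auto)

text \<open>
  The Cayley transform \<open>w \<mapsto> (w - 1)/(w + 1)\<close> carries the right half-plane into the disc and
  \<open>1\<close> to \<open>0\<close>, with derivative \<open>1/2\<close> at \<open>1\<close>, so this is Schwarz's lemma.
\<close>
lemma positive_real_part_deriv_bound:
  assumes hol: "q holomorphic_on unit_disc" and q0: "q 0 = 1"
    and pos: "\<And>z. z \<in> unit_disc \<Longrightarrow> Re (q z) > 0"
  shows "norm (deriv q 0) \<le> 2"
proof -
  define \<phi> where "\<phi> z = (q z - 1) / (q z + 1)" for z
  have nz: "q z + 1 \<noteq> 0" if "z \<in> unit_disc" for z
    using pos[OF that] by (auto simp: complex_eq_iff)
  have "\<phi> holomorphic_on unit_disc"
    unfolding \<phi>_def using hol nz by (auto intro!: holomorphic_intros)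
  moreover have "norm (\<phi> z) < 1" if "norm z < 1" for z
  proof -
    have "(norm (q z - 1))\<^sup>2 < (norm (q z + 1))\<^sup>2"
      unfolding cmod_power2 using pos[of z] that by (simp add: power2_eq_square algebra_simps)
    then have "norm (q z - 1) < norm (q z + 1)"
      by (rule power_less_imp_less_base) simp
    then show ?thesis
      unfolding \<phi>_def norm_divide using nz[of z] that by (subst divide_less_eq_1_pos) auto
  qed
  moreover have "\<phi> 0 = 0"
    by (simp add: \<phi>_def q0)
  ultimately have "norm (deriv \<phi> 0) \<le> 1"
    using Schwarz_Lemma(2)[of \<phi> 0] by simp
  moreover have "deriv \<phi> 0 = deriv q 0 / 2"
  proof -
    have "(q has_field_derivative deriv q 0) (at 0)"
      using hol by (rule holomorphic_derivI) auto
    then have "(\<phi> has_field_derivative deriv q 0 / 2) (at 0)"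
      unfolding \<phi>_def by (auto intro!: derivative_eq_intros simp: q0)
    then show ?thesis
      by (rule DERIV_imp_deriv)
  qed
  ultimately show ?thesis
    by (simp add: norm_divide)
qed

lemma sum_root_of_unity_powers:
  fixes k n :: nat
  assumes "k > 0"
  defines "\<omega> \<equiv> exp (2 * of_real pi * \<i> / of_nat k)"
  shows "(\<Sum>j<k. (\<omega> ^ j) ^ n) = (if k dvd n then of_nat k else 0)"
proof -
  have "\<omega> ^ n = exp (2 * of_real pi * \<i> * of_nat n / of_nat k)" for n
    by (simp add: \<omega>_def mult_ac flip: exp_of_nat_mult)
  then have root: "\<omega> ^ n = 1 \<longleftrightarrow> k dvd n" for n
    using complex_root_unity_eq_1[of k n] assms(1) by simp
  have "(\<Sum>j<k. (\<omega> ^ j) ^ n) = (\<Sum>j<k. (\<omega> ^ n) ^ j)"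
    by (simp add: mult.commute flip: power_mult)
  also have "\<dots> = (if k dvd n then of_nat k else 0)"
    using root[of n] root[of "n * k"] by (auto simp: sum_gp_strict power_mult)
  finally show ?thesis .
qed

text \<open>
  Averaging over rotations is what isolates every \<open>k\<close>-th coefficient while keeping the values in
  the right half-plane, which is convex.
\<close>
lemma root_of_unity_average_sums:
  fixes c :: "nat \<Rightarrow> complex" and k :: nat
  assumes k: "k > 0" and sums: "\<And>z. z \<in> unit_disc \<Longrightarrow> (\<lambda>n. c n * z ^ n) sums p z"
    and z: "z \<in> unit_disc"
  defines "\<omega> \<equiv> exp (2 * of_real pi * \<i> / of_nat k)"
  shows "(\<lambda>m. c (m * k) * (z ^ k) ^ m) sums ((\<Sum>j<k. p (\<omega> ^ j * z)) / of_nat k)"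
proof -
  have "norm \<omega> = 1"
    by (simp add: \<omega>_def norm_exp_eq_Re)
  then have "\<omega> ^ j * z \<in> unit_disc" for j
    using z by (simp add: norm_mult norm_power)
  then have "(\<lambda>n. (\<Sum>j<k. c n * (\<omega> ^ j * z) ^ n) / of_nat k) sums
               ((\<Sum>j<k. p (\<omega> ^ j * z)) / of_nat k)"
    by (intro sums_divide sums_sum sums)
  also have "(\<lambda>n. (\<Sum>j<k. c n * (\<omega> ^ j * z) ^ n) / of_nat k) =
               (\<lambda>n. if k dvd n then c n * z ^ n else 0)"
  proof
    fix n
    have "(\<Sum>j<k. c n * (\<omega> ^ j * z) ^ n) = c n * z ^ n * (\<Sum>j<k. (\<omega> ^ j) ^ n)"
      by (simp add: power_mult_distrib sum_distrib_left mult_ac)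
    then show "(\<Sum>j<k. c n * (\<omega> ^ j * z) ^ n) / of_nat k = (if k dvd n then c n * z ^ n else 0)"
      using k by (simp add: sum_root_of_unity_powers \<omega>_def)
  qed
  finally have filtered: "(\<lambda>n. if k dvd n then c n * z ^ n else 0) sums
                            ((\<Sum>j<k. p (\<omega> ^ j * z)) / of_nat k)" .
  have mono: "strict_mono (\<lambda>m. m * k)"
    using k by (simp add: strict_mono_def)
  have "(\<lambda>m. if k dvd m * k then c (m * k) * z ^ (m * k) else 0) sums
          ((\<Sum>j<k. p (\<omega> ^ j * z)) / of_nat k)"
    by (subst sums_mono_reindex[OF mono, of "\<lambda>n. if k dvd n then c n * z ^ n else 0"])
       (use filtered in \<open>auto elim!: dvdE simp: image_iff mult.commute\<close>)
  then show ?thesis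
    by (simp add: mult.commute flip: power_mult)
qed

lemma caratheodory_coefficient_bound:
  fixes c :: "nat \<Rightarrow> complex"
  assumes sums: "\<And>z. z \<in> unit_disc \<Longrightarrow> (\<lambda>n. c n * z ^ n) sums p z"
    and c0: "c 0 = 1" and pos: "\<And>z. z \<in> unit_disc \<Longrightarrow> Re (p z) > 0" and k: "k > 0"
  shows "norm (c k) \<le> 2"
proof -
  define q where "q w = (\<Sum>m. c (m * k) * w ^ m)" for w
  have q: "(\<lambda>m. c (m * k) * w ^ m) sums q w \<and> Re (q w) > 0" if w: "w \<in> unit_disc" for w
  proof -
    let ?\<omega> = "exp (2 * of_real pi * \<i> / of_nat k)"
    \<comment> \<open>Any \<open>k\<close>-th root of \<open>w\<close> will do; the logarithm provides one unless \<open>w = 0\<close>.\<close>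
    obtain z where z: "z ^ k = w"
    proof (cases "w = 0")
      case True
      then show ?thesis using that[of 0] k by simp
    next
      case False
      have "exp (Ln w / of_nat k) ^ k = w"
        using False k by (simp flip: exp_of_nat_mult)
      then show ?thesis using that by blast
    qed
    have "norm z ^ k < 1"
      using w z by (auto simp flip: norm_power)
    then have zd: "z \<in> unit_disc"
      by (metis dist_0_norm mem_ball not_less one_le_power)
    have s: "(\<lambda>m. c (m * k) * w ^ m) sums ((\<Sum>j<k. p (?\<omega> ^ j * z)) / of_nat k)"
      using root_of_unity_average_sums[OF k sums zd] z by simp
    have "?\<omega> ^ j * z \<in> unit_disc" for j
      using zd by (simp add: norm_mult norm_power norm_exp_eq_Re)
    then have "(\<Sum>j<k. Re (p (?\<omega> ^ j * z))) > 0"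
      using k by (intro sum_pos pos) auto
    then have "Re ((\<Sum>j<k. p (?\<omega> ^ j * z)) / of_nat k) > 0"
      using k by (simp add: Re_divide_of_nat)
    with s show ?thesis
      unfolding q_def by (simp add: sums_iff)
  qed
  have "q 0 = 1"
    using c0 by (simp add: q_def)
  then have "norm (deriv q 0) \<le> 2"
    using q by (intro positive_real_part_deriv_bound
        unit_disc_power_series_holomorphic[of "\<lambda>m. c (m * k)"]) auto
  moreover have "deriv q 0 = c k"
    using unit_disc_power_series_deriv_sums[of "\<lambda>m. c (m * k)" q 0] q
      powser_sums_zero[of "diffs (\<lambda>m. c (m * k))"]
    by (auto dest: sums_unique2 simp: diffs_def)
  ultimately show ?thesis
    by simp
qed

section \<open>Taylor coefficients of the defining expression\<close>

text \<open>
  The Taylor coefficients that a normalized expansion really stands for: the values of \<open>a\<close> at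
  \<open>0\<close> and \<open>1\<close> are unconstrained and have to be replaced.
\<close>
definition taylor_coeff :: "(nat \<Rightarrow> complex) \<Rightarrow> nat \<Rightarrow> complex" where
  "taylor_coeff a n = (if n = 0 then 0 else if n = 1 then 1 else a n)"

lemma normalized_expansion_iff_sums:
  "normalized_expansion f a \<longleftrightarrow> (\<forall>z\<in>unit_disc. (\<lambda>n. taylor_coeff a n * z ^ n) sums f z)"
proof -
  have "(\<lambda>n. taylor_coeff a n * z ^ n) sums f z \<longleftrightarrow>
          (\<lambda>n. a (n + 2) * z ^ (n + 2)) sums (f z - z)" for z
    using sums_iff_shift[of "\<lambda>n. taylor_coeff a n * z ^ n" 2 "f z - z"]
    by (simp add: taylor_coeff_def numeral_2_eq_2)
  then show ?thesis
    by (auto simp: normalized_expansion_def sums_iff)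
qed

text \<open>Differentiation and division by \<open>z\<close> act diagonally on coefficients, with the same shift.\<close>
lemma class_A_beta_expression_sums:
  assumes "normalized_expansion f a" and z: "z \<in> unit_disc"
  shows "(\<lambda>n. (of_real \<beta> + (1 - of_real \<beta>) * of_nat (Suc n)) * taylor_coeff a (Suc n) * z ^ n)
           sums (of_real \<beta> * quot_id f z + (1 - of_real \<beta>) * deriv f z)"
proof -
  let ?b = "taylor_coeff a"
  have f: "(\<lambda>n. ?b n * w ^ n) sums f w" if "w \<in> unit_disc" for w
    using assms(1) that by (simp add: normalized_expansion_iff_sums)
  have "(\<lambda>n. diffs ?b n * z ^ n) sums deriv f z"
    using f z by (rule unit_disc_power_series_deriv_sums)
  moreover have "(\<lambda>n. ?b (Suc n) * z ^ n) sums quot_id f z"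
  proof (cases "z = 0")
    case True
    then show ?thesis
      using powser_sums_zero[of "\<lambda>n. ?b (Suc n)"] by (simp add: quot_id_def taylor_coeff_def)
  next
    case False
    have "(\<lambda>n. ?b (Suc n) * z ^ Suc n) sums f z"
      using f[OF z] by (subst sums_Suc_iff) (simp add: taylor_coeff_def)
    from sums_divide[OF this, of z] show ?thesis
      using False by (simp add: quot_id_def)
  qed
  ultimately have "(\<lambda>n. of_real \<beta> * (?b (Suc n) * z ^ n) + (1 - of_real \<beta>) * (diffs ?b n * z ^ n))
      sums (of_real \<beta> * quot_id f z + (1 - of_real \<beta>) * deriv f z)"
    by (intro sums_add sums_mult)
  then show ?thesis
    by (simp add: diffs_def algebra_simps)
qed

lemma multiplier_ge_1:
  fixes \<beta> :: real
  assumes "\<beta> \<in> {0..1}" and "n \<ge> 1"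
  shows "real n - \<beta> * (real n - 1) \<ge> 1"
  using mult_right_mono[of \<beta> 1 "real n - 1"] assms by simp

theorem class_A_beta_coefficient_bound:
  assumes \<beta>: "\<beta> \<in> {0..1}" and f: "f \<in> class_A_beta \<beta>" and a: "normalized_expansion f a"
    and n: "n \<ge> 2"
  shows "norm (a n) \<le> 2 / (real n - \<beta> * (real n - 1))"
proof -
  let ?\<gamma> = "real n - \<beta> * (real n - 1)"
  let ?c = "\<lambda>n. (of_real \<beta> + (1 - of_real \<beta>) * of_nat (Suc n)) * taylor_coeff a (Suc n)"
  have "norm (?c (n - 1)) \<le> 2"
  proof (rule caratheodory_coefficient_bound[where c = ?c])
    show "(\<lambda>n. ?c n * z ^ n) sums (of_real \<beta> * quot_id f z + (1 - of_real \<beta>) * deriv f z)"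
      if "z \<in> unit_disc" for z
      using a that by (rule class_A_beta_expression_sums)
    show "Re (of_real \<beta> * quot_id f z + (1 - of_real \<beta>) * deriv f z) > 0"
      if "z \<in> unit_disc" for z
      using f that by (simp add: class_A_beta_def)
    show "?c 0 = 1" by (simp add: taylor_coeff_def)
    show "n - 1 > 0" using n by simp
  qed
  also have "?c (n - 1) = of_real ?\<gamma> * a n"
    using n by (simp add: taylor_coeff_def of_nat_diff algebra_simps)
  finally have "norm (a n) * \<bar>?\<gamma>\<bar> \<le> 2"
    by (simp only: norm_mult norm_of_real mult.commute)
  moreover have "?\<gamma> \<ge> 1"
    using multiplier_ge_1 \<beta> n by simp
  ultimately show ?thesis
    by (simp add: pos_le_divide_eq)
qed

section \<open>The extremal function\<close>

definition extremal_coeff :: "real \<Rightarrow> nat \<Rightarrow> complex" where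
  "extremal_coeff \<beta> n = of_real (2 / (real n - \<beta> * (real n - 1)))"

definition extremal_function :: "real \<Rightarrow> complex \<Rightarrow> complex" where
  "extremal_function \<beta> z = (\<Sum>n. taylor_coeff (extremal_coeff \<beta>) n * z ^ n)"

lemma norm_extremal_coeff:
  assumes "\<beta> \<in> {0..1}" and "n \<ge> 1"
  shows "norm (extremal_coeff \<beta> n) = 2 / (real n - \<beta> * (real n - 1))"
  using multiplier_ge_1[OF assms] by (simp add: extremal_coeff_def norm_divide del: of_real_divide)

lemma normalized_expansion_extremal:
  assumes \<beta>: "\<beta> \<in> {0..1}"
  shows "normalized_expansion (extremal_function \<beta>) (extremal_coeff \<beta>)"
  unfolding normalized_expansion_iff_sums extremal_function_def
proof (intro ballI summable_sums)
  fix z :: complex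
  assume "z \<in> unit_disc"
  then have geometric: "summable (\<lambda>n. 2 * norm z ^ n)"
    by (intro summable_mult summable_geometric) simp
  have "norm (taylor_coeff (extremal_coeff \<beta>) n) \<le> 2" for n
    using multiplier_ge_1[OF \<beta>, of n] norm_extremal_coeff[OF \<beta>, of n]
    by (auto simp: taylor_coeff_def field_simps)
  then show "summable (\<lambda>n. taylor_coeff (extremal_coeff \<beta>) n * z ^ n)"
    by (intro summable_comparison_test'[OF geometric, of 0])
       (auto simp: norm_mult norm_power intro!: mult_right_mono)
qed

lemma half_plane_map_sums:
  assumes "norm z < 1"
  shows "(\<lambda>n. (if n = 0 then 1 else 2) * z ^ n) sums ((1 + z) / (1 - z) :: complex)"
proof -
  have "(\<lambda>n. 2 * z ^ n - (if n = 0 then 1 else 0)) sums (2 * (1 / (1 - z)) - 1)"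
    by (intro sums_diff sums_mult geometric_sums assms) (use sums_single[of 0 "\<lambda>_. 1"] in simp)
  moreover have "2 * (1 / (1 - z)) - 1 = (1 + z) / (1 - z)"
  proof -
    have "1 - z \<noteq> 0"
      using assms by auto
    then show ?thesis
      by (simp add: divide_simps)
  qed
  moreover have "(\<lambda>n. 2 * z ^ n - (if n = 0 then 1 else 0)) =
                   (\<lambda>n. (if n = 0 then 1 else 2) * z ^ n)"
    by auto
  ultimately show ?thesis
    by simp
qed

lemma Re_half_plane_map_pos:
  assumes "norm z < 1"
  shows "Re ((1 + z) / (1 - z)) > 0"
proof -
  have "(Re z)\<^sup>2 + (Im z)\<^sup>2 < 1"
    unfolding cmod_power2[symmetric] using assms by (simp add: power_less_one_iff)
  moreover have "1 - z \<noteq> 0"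
    using assms by auto
  ultimately show ?thesis
    by (simp add: Re_complex_div_gt_0 power2_eq_square algebra_simps)
qed

lemma extremal_function_in_class_A_beta:
  assumes \<beta>: "\<beta> \<in> {0..1}"
  shows "extremal_function \<beta> \<in> class_A_beta \<beta>"
proof -
  let ?f = "extremal_function \<beta>" and ?b = "taylor_coeff (extremal_coeff \<beta>)"
  have a: "normalized_expansion ?f (extremal_coeff \<beta>)"
    using \<beta> by (rule normalized_expansion_extremal)
  then have "?f holomorphic_on unit_disc"
    by (intro unit_disc_power_series_holomorphic) (auto simp: normalized_expansion_iff_sums)
  moreover have "Re (of_real \<beta> * quot_id ?f z + (1 - of_real \<beta>) * deriv ?f z) > 0"
    if z: "z \<in> unit_disc" for z
  proof -
    have "(of_real \<beta> + (1 - of_real \<beta>) * of_nat (Suc n)) * ?b (Suc n) =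
            (if n = 0 then 1 else 2)" for n
    proof (cases "n = 0")
      case False
      let ?\<gamma> = "real (Suc n) - \<beta> * (real (Suc n) - 1)"
      have "of_real \<beta> + (1 - of_real \<beta>) * of_nat (Suc n) = (of_real ?\<gamma> :: complex)"
        by (simp add: algebra_simps)
      moreover have "?b (Suc n) = of_real (2 / ?\<gamma>)"
        using False by (simp add: taylor_coeff_def extremal_coeff_def)
      moreover have "?\<gamma> * (2 / ?\<gamma>) = 2"
      proof -
        have "?\<gamma> \<noteq> 0"
          using multiplier_ge_1[OF \<beta>, of "Suc n"] by linarith
        then show ?thesis
          by (metis nonzero_mult_div_cancel_left times_divide_eq_right)
      qed
      ultimately have "(of_real \<beta> + (1 - of_real \<beta>) * of_nat (Suc n)) * ?b (Suc n) = of_real 2"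
        by (metis of_real_mult)
      with False show ?thesis
        by simp
    qed (simp add: taylor_coeff_def)
    with class_A_beta_expression_sums[OF a z, of \<beta>]
    have "(\<lambda>n. (if n = 0 then 1 else 2) * z ^ n) sums
            (of_real \<beta> * quot_id ?f z + (1 - of_real \<beta>) * deriv ?f z)"
      by simp
    moreover have "(\<lambda>n. (if n = 0 then 1 else 2) * z ^ n) sums ((1 + z) / (1 - z))"
      using z by (intro half_plane_map_sums) simp
    ultimately have "of_real \<beta> * quot_id ?f z + (1 - of_real \<beta>) * deriv ?f z = (1 + z) / (1 - z)"
      by (rule sums_unique2)
    then show ?thesis
      using Re_half_plane_map_pos[of z] z by simp
  qed
  ultimately show ?thesis
    using a by (auto simp: class_A_beta_def class_A_def)
qed

section \<open>The sharp coefficient bound\<close>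

theorem theorem2p1:
  fixes \<beta> :: real
  assumes "\<beta> \<in> {0..1}"
  shows "(\<forall>f \<in> class_A_beta \<beta>. \<forall>a. normalized_expansion f a \<longrightarrow>
            (\<forall>n\<ge>2. norm (a n) \<le> 2 / (real n - \<beta> * (real n - 1)))) \<and>
         (\<forall>n\<ge>2. \<exists>f \<in> class_A_beta \<beta>. \<exists>a. normalized_expansion f a \<and>
            norm (a n) = 2 / (real n - \<beta> * (real n - 1)))"
proof (intro conjI ballI allI impI)
  fix f a and n :: nat
  assume "f \<in> class_A_beta \<beta>" "normalized_expansion f a" "n \<ge> 2"
  with assms show "norm (a n) \<le> 2 / (real n - \<beta> * (real n - 1))"
    by (rule class_A_beta_coefficient_bound)
next
  fix n :: nat
  assume "n \<ge> 2"
  then show "\<exists>f \<in> class_A_beta \<beta>. \<exists>a. normalized_expansion f a \<and>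
               norm (a n) = 2 / (real n - \<beta> * (real n - 1))"
    using extremal_function_in_class_A_beta normalized_expansion_extremal norm_extremal_coeff assms
    by (intro bexI[of _ "extremal_function \<beta>"] exI[of _ "extremal_coeff \<beta>"]) auto
qed

end
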